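(* Let $m,n,k\ge1$, $\alpha_1,\alpha_2\in\mathbb C$, let $B$ be a complex $m\times n$ matrix and $\beta\in\mathbb C$ with $|\beta|=\|B\|$. Let $V_1,V_2\in\mathcal M_k(\mathbb C)$, and let $U$ be a $k\times k$ unitary such that $D_1=UV_1V_1^*U^*$ is diagonal. Put $$P^{(k)}_{\mathbf B}(V)=\begin{pmatrix}\alpha_1V_1\otimes I_m&V_2\otimes B\\0&\alpha_2V_1\otimes I_n\end{pmatrix}.$$ Then $\|P_{\mathbf B}^{(k)}(V)\|<1$ if and only if $I_k-|\alpha_2|^2D_1>0$ and $$I_k-|\alpha_1|^2D_1-|\beta|^2UV_2V_2^*U^*-|\alpha_2\beta|^2UV_2V_1^*U^*(I_k-|\alpha_2|^2D_1)^{-1}UV_1V_2^*U^*>0.$$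
   Context: Norms of matrices are operator norms; $X>0$ means positive definite. Here $\mathbf B=(B_1,B_2)$ with $B_1=\begin{pmatrix}\alpha_1I_m&0\\0&\alpha_2I_n\end{pmatrix}$ and $B_2=\begin{pmatrix}0&B\\0&0\end{pmatrix}$ in $\mathcal M_{m+n}(\mathbb C)$, and $P_{\mathbf B}(z_1,z_2)=z_1B_1+z_2B_2$; $P_{\mathbf B}^{(k)}(V)$ is the entrywise application of $P_{\mathbf B}$ to the $k\times k$ matrix $V=(\mathbf v_{ij})$ with entries $\mathbf v_{ij}=(v_{ij}^1,v_{ij}^2)\in\mathbb C^2$, where $V_1=(v^1_{ij})$, $V_2=(v^2_{ij})$. *)

theory Defs
  imports "HOL-Analysis.Analysis"
begin

text \<open>A complex \<open>m \<times> n\<close> matrix is an element of \<^typ>\<open>complex^'n^'m\<close> with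
  \<open>CARD('m) = m\<close> and \<open>CARD('n) = n\<close>; all index types are nonempty, so \<open>m, n \<ge> 1\<close> is automatic.\<close>

definition conj_transpose :: "complex^'n^'m \<Rightarrow> complex^'m^'n"
  where "conj_transpose A = map_matrix cnj (transpose A)"

definition unitary_matrix :: "complex^'n^'n \<Rightarrow> bool"
  where "unitary_matrix U \<longleftrightarrow> conj_transpose U ** U = mat 1 \<and> U ** conj_transpose U = mat 1"

definition diagonal_matrix :: "complex^'n^'n \<Rightarrow> bool"
  where "diagonal_matrix A \<longleftrightarrow> (\<forall>i j. i \<noteq> j \<longrightarrow> A $ i $ j = 0)"

definition positive_definite :: "complex^'n^'n \<Rightarrow> bool"
  where "positive_definite X \<longleftrightarrow>
    conj_transpose X = X \<and> (\<forall>x. x \<noteq> 0 \<longrightarrow> 0 < Re (\<Sum>i\<in>UNIV. cnj (x $ i) * (X *v x) $ i))"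

text \<open>The norm of \<^typ>\<open>complex^'n\<close> is the Euclidean one, so this is the operator norm
  between Hilbert spaces. (The library's \<^const>\<open>norm\<close> on \<^typ>\<open>complex^'n^'m\<close> is
  instead the Frobenius norm.)\<close>

definition op_norm :: "complex^'n^'m \<Rightarrow> real"
  where "op_norm A = onorm (\<lambda>x. A *v x)"

definition scale_matrix :: "complex \<Rightarrow> complex^'n^'m \<Rightarrow> complex^'n^'m"
  where "scale_matrix c A = map_matrix (\<lambda>z. c * z) A"

text \<open>Kronecker product; the first component of an index selects the block.\<close>

definition kronecker :: "complex^'b^'a \<Rightarrow> complex^'d^'c \<Rightarrow> complex^('b::finite \<times> 'd::finite)^('a::finite \<times> 'c::finite)"
  where "kronecker A B = (\<chi> p q. A $ fst p $ fst q * B $ snd p $ snd q)"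

definition block_matrix ::
  "complex^'a^'c \<Rightarrow> complex^'b^'c \<Rightarrow> complex^'a^'d \<Rightarrow> complex^'b^'d \<Rightarrow> complex^('a::finite + 'b::finite)^('c::finite + 'd::finite)"
  where "block_matrix P Q R S =
    (\<chi> r s. case r of
       Inl i \<Rightarrow> (case s of Inl j \<Rightarrow> P $ i $ j | Inr j \<Rightarrow> Q $ i $ j)
     | Inr i \<Rightarrow> (case s of Inl j \<Rightarrow> R $ i $ j | Inr j \<Rightarrow> S $ i $ j))"

definition B\<^sub>1 :: "complex \<Rightarrow> complex \<Rightarrow> complex^('m::finite + 'n::finite)^('m + 'n)"
  where "B\<^sub>1 \<alpha>\<^sub>1 \<alpha>\<^sub>2 = block_matrix (scale_matrix \<alpha>\<^sub>1 (mat 1)) 0 0 (scale_matrix \<alpha>\<^sub>2 (mat 1))"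

definition B\<^sub>2 :: "complex^'n^'m \<Rightarrow> complex^('m::finite + 'n::finite)^('m + 'n)"
  where "B\<^sub>2 B = block_matrix 0 B 0 0"

definition P\<^sub>B :: "complex \<Rightarrow> complex \<Rightarrow> complex^'n^'m \<Rightarrow> complex \<times> complex \<Rightarrow> complex^('m::finite + 'n::finite)^('m + 'n)"
  where "P\<^sub>B \<alpha>\<^sub>1 \<alpha>\<^sub>2 B z = scale_matrix (fst z) (B\<^sub>1 \<alpha>\<^sub>1 \<alpha>\<^sub>2) + scale_matrix (snd z) (B\<^sub>2 B)"

definition P\<^sub>B_amp ::
  "complex \<Rightarrow> complex \<Rightarrow> complex^'n^'m \<Rightarrow> complex^'k^'k \<Rightarrow> complex^'k^'k
    \<Rightarrow> complex^('k::finite \<times> 'm::finite + 'k \<times> 'n::finite)^('k \<times> 'm + 'k \<times> 'n)"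
  where "P\<^sub>B_amp \<alpha>\<^sub>1 \<alpha>\<^sub>2 B V\<^sub>1 V\<^sub>2 =
    block_matrix
      (kronecker (scale_matrix \<alpha>\<^sub>1 V\<^sub>1) (mat 1)) (kronecker V\<^sub>2 B)
      0 (kronecker (scale_matrix \<alpha>\<^sub>2 V\<^sub>1) (mat 1))"

text \<open>\<^const>\<open>P\<^sub>B_amp\<close> is the entrywise application of \<^const>\<open>P\<^sub>B\<close> to the \<open>k \<times> k\<close> matrix with
  entries \<open>(V\<^sub>1 $ i $ j, V\<^sub>2 $ i $ j)\<close>, up to the permutation of the basis that identifies
  \<open>'k \<times> ('m + 'n)\<close> with \<open>'k \<times> 'm + 'k \<times> 'n\<close>.\<close>

definition regroup :: "'k \<Rightarrow> 'm + 'n \<Rightarrow> 'k \<times> 'm + 'k \<times> 'n"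
  where "regroup i a = map_sum (Pair i) (Pair i) a"

lemma bij_regroup: "bij (case_prod regroup)"
proof (rule bijI)
  show "inj (case_prod regroup)"
    by (auto simp: inj_def regroup_def map_sum_def split: sum.splits)
  show "surj (case_prod regroup)"
  proof (rule surjI)
    show "case_prod regroup (case s of Inl p \<Rightarrow> (fst p, Inl (snd p)) | Inr p \<Rightarrow> (fst p, Inr (snd p))) = s"
      for s :: "'k \<times> 'm + 'k \<times> 'n"
      by (auto simp: regroup_def split: sum.splits)
  qed
qed

lemma P\<^sub>B_amp_entrywise:
  "P\<^sub>B_amp \<alpha>\<^sub>1 \<alpha>\<^sub>2 B V\<^sub>1 V\<^sub>2 $ regroup i a $ regroup j b
    = P\<^sub>B \<alpha>\<^sub>1 \<alpha>\<^sub>2 B (V\<^sub>1 $ i $ j, V\<^sub>2 $ i $ j) $ a $ b"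
  by (cases a; cases b)
    (simp_all add: P\<^sub>B_amp_def P\<^sub>B_def B\<^sub>1_def B\<^sub>2_def regroup_def block_matrix_def kronecker_def
      scale_matrix_def mat_def)

end

theory Submission
  imports Defs
begin

text \<open>The norm of \<open>P\<close> is that of its adjoint, and \<open>P\<^sup>*\<close> acts on pairs of matrices \<open>(X, Y)\<close>
  with Frobenius norms by \<open>(C\<^sub>1\<^sup>* X, A\<^sup>* X cnj(B) + C\<^sub>2\<^sup>* Y)\<close>, where \<open>A = V\<^sub>2\<close> and \<open>C\<^sub>i = \<alpha>\<^sub>i V\<^sub>1\<close>. Since
  Frobenius norms are unitarily invariant, \<open>V\<^sub>i\<close> may be replaced by \<open>U V\<^sub>i\<close>, so that
  \<open>W = I - C\<^sub>2 C\<^sub>2\<^sup>*\<close> is diagonal. Maximising over the rows of \<open>Y\<close> then produces the Schur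
  complement with \<open>W\<^sup>-\<^sup>1\<close>. In the resulting inequality for \<open>X\<close>, all occurrences of \<open>B\<close> are of the
  form \<open>\<parallel>Z cnj(B)\<parallel>\<close>, at most \<open>\<parallel>B\<parallel> \<parallel>Z\<parallel>\<close>; this lets one argue column by column, and
  rank-one \<open>X = x u\<^sup>T\<close> with \<open>u\<close> norming for \<open>B\<^sup>*\<close> give equality.\<close>

section \<open>Algebra of conjugate transposes and scalar multiples\<close>

lemma conj_transpose_nth [simp]: "conj_transpose A $ i $ j = cnj (A $ j $ i)"
  by (simp add: conj_transpose_def map_matrix_def transpose_def)

lemma conj_transpose_conj_transpose [simp]: "conj_transpose (conj_transpose A) = A"
  by (simp add: vec_eq_iff)

lemma conj_transpose_matrix_mul: "conj_transpose (A ** B) = conj_transpose B ** conj_transpose A"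
  by (simp add: vec_eq_iff matrix_matrix_mult_def mult.commute)

lemma conj_transpose_mat_1 [simp]: "conj_transpose (mat 1) = mat 1"
  by (auto simp: vec_eq_iff mat_def)

lemma conj_transpose_diff: "conj_transpose (A - B) = conj_transpose A - conj_transpose B"
  by (simp add: vec_eq_iff)

lemma conj_transpose_scaleR: "conj_transpose (c *\<^sub>R A) = c *\<^sub>R conj_transpose A"
  by (simp add: vec_eq_iff)

lemma scale_matrix_nth [simp]: "scale_matrix c A $ i $ j = c * A $ i $ j"
  by (simp add: scale_matrix_def map_matrix_def)

lemma matrix_mul_scale_right: "U ** scale_matrix c A = scale_matrix c (U ** A)"
  by (simp add: vec_eq_iff matrix_matrix_mult_def sum_distrib_left mult_ac)

lemma scale_mul_conj_transpose:
  "scale_matrix c A ** conj_transpose (scale_matrix c A) = (cmod c)\<^sup>2 *\<^sub>R (A ** conj_transpose A)"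
proof -
  have "(c * z) * (cnj c * y) = (cmod c)\<^sup>2 *\<^sub>R (z * y)" for z y
    unfolding scaleR_conv_of_real complex_norm_square by (simp add: mult_ac)
  then show ?thesis
    by (simp add: vec_eq_iff matrix_matrix_mult_def scaleR_sum_right)
qed

section \<open>Adjoints for the real inner product, on vectors and on matrices\<close>

lemma inner_complex_cnj: "(a * x) \<bullet> y = x \<bullet> (cnj a * y)" for a x y :: complex
  by (simp add: inner_complex_def algebra_simps)

text \<open>The inner product here is the real part of the Hermitian one. It induces the same norm,
  and multiplication by a scalar still has its conjugate as adjoint, so real inner products suffice
  throughout.\<close>

lemma inner_conj_transpose_right:
  "(A *v x) \<bullet> y = x \<bullet> (conj_transpose A *v y)" for A :: "complex^'n^'m"
proof -
  have "(A *v x) \<bullet> y = (\<Sum>i\<in>UNIV. \<Sum>j\<in>UNIV. x $ j \<bullet> (cnj (A $ i $ j) * y $ i))"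
    by (simp add: inner_vec_def matrix_vector_mult_def inner_sum_left inner_complex_cnj)
  also have "\<dots> = x \<bullet> (conj_transpose A *v y)"
    by (subst sum.swap) (simp add: inner_vec_def matrix_vector_mult_def inner_sum_right)
  finally show ?thesis .
qed

text \<open>Left multiplication acts on each column separately, so this splitting carries adjoint
  identities from vectors over to matrices with the Frobenius inner product.\<close>

lemma inner_eq_sum_columns:
  "X \<bullet> Y = (\<Sum>j\<in>UNIV. column j X \<bullet> column j Y)" for X Y :: "complex^'n^'m"
  unfolding inner_vec_def column_def by (subst sum.swap) simp

lemma norm_sq_sum_columns:
  "(norm X)\<^sup>2 = (\<Sum>j\<in>UNIV. (norm (column j X))\<^sup>2)" for X :: "complex^'n^'m"
  by (simp add: power2_norm_eq_inner inner_eq_sum_columns)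

lemma norm_sq_sum_rows:
  "(norm X)\<^sup>2 = (\<Sum>i\<in>UNIV. (norm (X $ i))\<^sup>2)" for X :: "'a::real_inner^'m"
  by (simp add: power2_norm_eq_inner inner_vec_def)

lemma column_matrix_mul: "column j (A ** X) = A *v column j X"
  by (simp add: vec_eq_iff column_def matrix_matrix_mult_def matrix_vector_mult_def)

lemma inner_matrix_mul_right:
  "(A ** X) \<bullet> Y = X \<bullet> (conj_transpose A ** Y)" for A :: "complex^'n^'m" and X :: "complex^'l^'n"
  by (simp add: inner_eq_sum_columns column_matrix_mul inner_conj_transpose_right)

section \<open>Operator norms and positive definiteness\<close>

lemma norm_mat_le_op_norm: "norm (A *v x) \<le> op_norm A * norm x"
  unfolding op_norm_def by (rule onorm[OF matrix_vector_mul_bounded_linear])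

lemma op_norm_nonneg: "0 \<le> op_norm A"
  unfolding op_norm_def by (rule onorm_pos_le[OF matrix_vector_mul_bounded_linear])

text \<open>The unit sphere is compact, so the continuous function \<open>norm (A *v x)\<close> has
  a maximiser on it; by homogeneity its value bounds \<open>A\<close> everywhere.\<close>

lemma op_norm_attained:
  fixes A :: "complex^'n^'m"
  obtains x where "norm x = 1" "norm (A *v x) = op_norm A"
proof -
  have "axis undefined 1 \<in> sphere (0::complex^'n) 1" by (simp add: norm_axis_1)
  moreover have "continuous_on (sphere 0 1) (\<lambda>x. norm (A *v x))"
    by (intro continuous_intros bounded_linear.continuous_on[OF matrix_vector_mul_bounded_linear])
  ultimately obtain x where x: "norm x = 1" "\<And>y. norm y = 1 \<Longrightarrow> norm (A *v y) \<le> norm (A *v x)"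
    using continuous_attains_sup[of "sphere (0::complex^'n) 1" "\<lambda>x. norm (A *v x)"] by force
  have "norm (A *v y) \<le> norm (A *v x) * norm y" for y
  proof (cases "y = 0")
    case False
    have "A *v ((1 / norm y) *\<^sub>R y) = (1 / norm y) *\<^sub>R (A *v y)"
      by (rule linear_scale[OF bounded_linear.linear[OF matrix_vector_mul_bounded_linear]])
    with x(2)[of "(1 / norm y) *\<^sub>R y"] False show ?thesis
      by (simp add: divide_simps)
  qed simp
  then have "op_norm A \<le> norm (A *v x)"
    unfolding op_norm_def by (intro onorm_le)
  with norm_mat_le_op_norm[of A x] x(1) have "norm (A *v x) = op_norm A" by simp
  with x(1) that show thesis by blast
qed

text \<open>For a unit vector \<open>y\<close> that attains the norm of the adjoint, put z = A* y.
  Then |z|^2 = <A z, y> is at most the norm of \<open>A\<close> times |z|, and |z| cancels.\<close>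

lemma op_norm_conj_transpose_le: "op_norm (conj_transpose A) \<le> op_norm A"
  for A :: "complex^'n^'m"
proof -
  obtain y where y: "norm y = 1" "norm (conj_transpose A *v y) = op_norm (conj_transpose A)"
    using op_norm_attained by blast
  let ?z = "conj_transpose A *v y"
  have "(norm ?z)\<^sup>2 = (A *v ?z) \<bullet> y"
    by (simp add: power2_norm_eq_inner inner_conj_transpose_right)
  also have "\<dots> \<le> norm (A *v ?z) * norm y" by (rule norm_cauchy_schwarz)
  also have "\<dots> \<le> op_norm A * norm ?z" using y(1) norm_mat_le_op_norm by simp
  finally have "norm ?z * norm ?z \<le> op_norm A * norm ?z" by (simp add: power2_eq_square)
  then have "norm ?z \<le> op_norm A"
    using op_norm_nonneg[of A] by (cases "norm ?z = 0") (simp_all add: mult_le_cancel_right)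
  with y show ?thesis by simp
qed

lemma op_norm_conj_transpose: "op_norm (conj_transpose A) = op_norm A"
  using op_norm_conj_transpose_le[of A] op_norm_conj_transpose_le[of "conj_transpose A"] by simp

text \<open>Attainment is what makes the pointwise strict inequality give a strict bound on the
  supremum.\<close>

lemma op_norm_less_1_iff: "op_norm A < 1 \<longleftrightarrow> (\<forall>x. x \<noteq> 0 \<longrightarrow> (norm (A *v x))\<^sup>2 < (norm x)\<^sup>2)"
  (is "_ \<longleftrightarrow> ?R")
proof
  assume *: "op_norm A < 1"
  show ?R
  proof (intro allI impI)
    fix x :: "complex^'a" assume "x \<noteq> 0"
    then have "op_norm A * norm x < 1 * norm x" using * by (intro mult_strict_right_mono) auto
    then have "norm (A *v x) < norm x" using norm_mat_le_op_norm[of A x] by simp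
    then show "(norm (A *v x))\<^sup>2 < (norm x)\<^sup>2" by (intro power_strict_mono) auto
  qed
next
  assume R: ?R
  obtain x where x: "norm x = 1" "norm (A *v x) = op_norm A" using op_norm_attained by blast
  from R x have "(op_norm A)\<^sup>2 < 1\<^sup>2" by (metis norm_zero zero_neq_one)
  then show "op_norm A < 1" by (rule power_less_imp_less_base) simp
qed

lemma positive_definite_iff:
  "positive_definite X \<longleftrightarrow> conj_transpose X = X \<and> (\<forall>x. x \<noteq> 0 \<longrightarrow> 0 < x \<bullet> (X *v x))"
proof -
  have "Re (\<Sum>i\<in>UNIV. cnj (x $ i) * (X *v x) $ i) = x \<bullet> (X *v x)" for x
    by (simp add: inner_vec_def inner_complex_def)
  then show ?thesis by (simp add: positive_definite_def)
qed

lemma inner_mul_conj_transpose: "x \<bullet> ((A ** conj_transpose A) *v x) = (norm (conj_transpose A *v x))\<^sup>2"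
  by (metis conj_transpose_conj_transpose inner_conj_transpose_right matrix_vector_mul_assoc power2_norm_eq_inner)

section \<open>Vectors over the block index as pairs of matrices\<close>

text \<open>Reading the pair index as row and column turns the Euclidean norm into the Frobenius
  norm, and a Kronecker product with the identity into left multiplication.\<close>

definition upper_part :: "complex^('k::finite \<times> 'm::finite + 'k \<times> 'n::finite) \<Rightarrow> complex^'m^'k"
  where "upper_part z = (\<chi> i a. z $ Inl (i, a))"

definition lower_part :: "complex^('k::finite \<times> 'm::finite + 'k \<times> 'n::finite) \<Rightarrow> complex^'n^'k"
  where "lower_part z = (\<chi> i a. z $ Inr (i, a))"

definition join_parts :: "complex^'m^'k \<Rightarrow> complex^'n^'k \<Rightarrow> complex^('k::finite \<times> 'm::finite + 'k \<times> 'n::finite)"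
  where "join_parts X Y = (\<chi> s. case s of Inl p \<Rightarrow> X $ fst p $ snd p | Inr p \<Rightarrow> Y $ fst p $ snd p)"

lemma parts_join [simp]: "upper_part (join_parts X Y) = X" "lower_part (join_parts X Y) = Y"
  by (simp_all add: vec_eq_iff upper_part_def lower_part_def join_parts_def)

lemma sum_UNIV_sum:
  fixes f :: "'a::finite + 'b::finite \<Rightarrow> 'c::comm_monoid_add"
  shows "sum f UNIV = (\<Sum>p\<in>UNIV. f (Inl p)) + (\<Sum>p\<in>UNIV. f (Inr p))"
  by (simp add: UNIV_Plus_UNIV[symmetric] sum.Plus del: UNIV_Plus_UNIV)

lemma sum_UNIV_prod:
  fixes f :: "'a::finite \<times> 'b::finite \<Rightarrow> 'c::comm_monoid_add"
  shows "sum f UNIV = (\<Sum>i\<in>UNIV. \<Sum>j\<in>UNIV. f (i, j))"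
  by (simp add: UNIV_Times_UNIV[symmetric] sum.cartesian_product del: UNIV_Times_UNIV)

lemma norm_sq_parts:
  "(norm z)\<^sup>2 = (norm (upper_part z))\<^sup>2 + (norm (lower_part z))\<^sup>2"
  for z :: "complex^('k::finite \<times> 'm::finite + 'k \<times> 'n::finite)"
  by (simp add: norm_sq_sum_rows sum_UNIV_sum sum_UNIV_prod upper_part_def lower_part_def)

text \<open>The shape of \<open>P\<^sub>B_amp\<close> with independent diagonal blocks, so that it
  also covers the matrices multiplied by the unitary.\<close>

definition block_upper ::
  "complex^'k^'k \<Rightarrow> complex^'k^'k \<Rightarrow> complex^'k^'k \<Rightarrow> complex^'n^'m
    \<Rightarrow> complex^('k::finite \<times> 'm::finite + 'k \<times> 'n::finite)^('k \<times> 'm + 'k \<times> 'n)"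
  where "block_upper C\<^sub>1 A C\<^sub>2 B =
    block_matrix (kronecker C\<^sub>1 (mat 1)) (kronecker A B) 0 (kronecker C\<^sub>2 (mat 1))"

lemma if_zero_mult:
  "(if P then x else 0) * y = (if P then x * y else 0)"
  "y * (if P then x else 0) = (if P then y * x else 0)" for x y :: complex
  by auto

lemma upper_part_block:
  "upper_part (conj_transpose (block_upper C\<^sub>1 A C\<^sub>2 B) *v z) = conj_transpose C\<^sub>1 ** upper_part z"
  by (simp add: vec_eq_iff upper_part_def block_upper_def matrix_vector_mult_def
      matrix_matrix_mult_def sum_UNIV_sum sum_UNIV_prod block_matrix_def kronecker_def mat_def
      if_zero_mult if_distrib[of cnj] sum.delta cong: if_cong)

lemma lower_part_block:
  "lower_part (conj_transpose (block_upper C\<^sub>1 A C\<^sub>2 B) *v z)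
    = conj_transpose A ** upper_part z ** map_matrix cnj B + conj_transpose C\<^sub>2 ** lower_part z"
proof -
  have "(\<Sum>l\<in>UNIV. \<Sum>a\<in>UNIV. cnj (A $ l $ i) * cnj (B $ a $ j) * z $ Inl (l, a))
      = (\<Sum>a\<in>UNIV. \<Sum>l\<in>UNIV. cnj (A $ l $ i) * z $ Inl (l, a) * cnj (B $ a $ j))" for i j
    by (subst sum.swap) (simp add: mult_ac)
  then show ?thesis
    by (simp add: vec_eq_iff upper_part_def lower_part_def block_upper_def matrix_vector_mult_def
        matrix_matrix_mult_def sum_UNIV_sum sum_UNIV_prod block_matrix_def kronecker_def mat_def
        if_zero_mult if_distrib[of cnj] sum.delta map_matrix_def sum_distrib_right cong: if_cong)
qed

text \<open>Passing to the adjoint makes the part quadratic in \<open>Y\<close> involve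
  \<open>C\<^sub>2 ** conj_transpose C\<^sub>2\<close>, the product that will be diagonal.\<close>

lemma op_norm_block_less_1_iff:
  "op_norm (block_upper C\<^sub>1 A C\<^sub>2 B) < 1 \<longleftrightarrow>
    (\<forall>X Y. X \<noteq> 0 \<or> Y \<noteq> 0 \<longrightarrow>
      (norm (conj_transpose C\<^sub>1 ** X))\<^sup>2
        + (norm (conj_transpose A ** X ** map_matrix cnj B + conj_transpose C\<^sub>2 ** Y))\<^sup>2
      < (norm X)\<^sup>2 + (norm Y)\<^sup>2)"
  (is "?L \<longleftrightarrow> (\<forall>X Y. X \<noteq> 0 \<or> Y \<noteq> 0 \<longrightarrow> ?Q X Y)")
proof -
  have zero: "z \<noteq> 0 \<longleftrightarrow> upper_part z \<noteq> 0 \<or> lower_part z \<noteq> 0"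
    for z :: "complex^('k::finite \<times> 'm::finite + 'k \<times> 'n::finite)"
  proof -
    have "norm z = 0 \<longleftrightarrow> norm (upper_part z) = 0 \<and> norm (lower_part z) = 0"
      using norm_sq_parts[of z] by (metis add_0 power_zero_numeral sum_power2_eq_zero_iff zero_eq_power2)
    then show ?thesis by simp
  qed
  have "?L \<longleftrightarrow> (\<forall>z. z \<noteq> 0 \<longrightarrow> ?Q (upper_part z) (lower_part z))"
    unfolding op_norm_conj_transpose[of "block_upper C\<^sub>1 A C\<^sub>2 B", symmetric] op_norm_less_1_iff norm_sq_parts
      upper_part_block lower_part_block ..
  also have "\<dots> \<longleftrightarrow> (\<forall>X Y. X \<noteq> 0 \<or> Y \<noteq> 0 \<longrightarrow> ?Q X Y)"
    unfolding zero by (metis parts_join)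
  finally show ?thesis .
qed

section \<open>Completing the square row by row, and bounds for multiplication by the conjugate of
  B\<close>

lemma row_diagonal_mul:
  assumes "diagonal_matrix D"
  shows "(D ** Y) $ i = D $ i $ i *s Y $ i"
proof -
  have "(\<Sum>k\<in>UNIV. D $ i $ k * Y $ k $ j) = (\<Sum>k\<in>UNIV. if k = i then D $ i $ i * Y $ i $ j else 0)" for j
    using assms by (intro sum.cong) (auto simp: diagonal_matrix_def)
  then show ?thesis by (simp add: vec_eq_iff matrix_matrix_mult_def)
qed

lemma inner_scale_self: "x \<bullet> (c *s x) = Re c * (norm x)\<^sup>2" for x :: "complex^'n"
  unfolding power2_norm_eq_inner
  by (simp add: inner_vec_def sum_distrib_left inner_complex_def algebra_simps)

text \<open>Expand the square. In the mixed term \<open>C\<close> moves over to \<open>R\<close>;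
  the term quadratic in \<open>Y\<close> contains only C C*, which is diagonal, so the rows of
  \<open>Y\<close> decouple. The \<open>w i\<close> are the diagonal entries of I - C C*.\<close>

lemma norm_sq_add_conj_transpose_mul:
  fixes R Y :: "complex^'n^'k" and C :: "complex^'k^'k"
  assumes "diagonal_matrix (C ** conj_transpose C)"
  defines "w \<equiv> \<lambda>i. 1 - Re ((C ** conj_transpose C) $ i $ i)"
  shows "(norm (R + conj_transpose C ** Y))\<^sup>2 =
    (norm Y)\<^sup>2 + (norm R)\<^sup>2 + (\<Sum>i\<in>UNIV. 2 * ((C ** R) $ i \<bullet> Y $ i) - w i * (norm (Y $ i))\<^sup>2)"
proof -
  have 1: "R \<bullet> (conj_transpose C ** Y) = (\<Sum>i\<in>UNIV. (C ** R) $ i \<bullet> Y $ i)"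
    using inner_matrix_mul_right[of C R Y] by (simp add: inner_vec_def)
  have "(norm (conj_transpose C ** Y))\<^sup>2 = Y \<bullet> ((C ** conj_transpose C) ** Y)"
    using inner_matrix_mul_right[of "conj_transpose C" Y "conj_transpose C ** Y"]
    by (simp add: power2_norm_eq_inner matrix_mul_assoc)
  also have "\<dots> = (\<Sum>i\<in>UNIV. (1 - w i) * (norm (Y $ i))\<^sup>2)"
    unfolding inner_vec_def[of Y] row_diagonal_mul[OF assms(1)] inner_scale_self by (simp add: w_def)
  also have "\<dots> = (norm Y)\<^sup>2 - (\<Sum>i\<in>UNIV. w i * (norm (Y $ i))\<^sup>2)"
    by (simp add: norm_sq_sum_rows[of Y] sum_subtractf left_diff_distrib)
  finally have 2: "(norm (conj_transpose C ** Y))\<^sup>2 = (norm Y)\<^sup>2 - (\<Sum>i\<in>UNIV. w i * (norm (Y $ i))\<^sup>2)" .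
  have "(norm (R + conj_transpose C ** Y))\<^sup>2
      = (norm R)\<^sup>2 + 2 * (R \<bullet> (conj_transpose C ** Y)) + (norm (conj_transpose C ** Y))\<^sup>2"
    unfolding power2_norm_eq_inner by (simp add: inner_add_left inner_add_right inner_commute)
  then show ?thesis unfolding 1 2 by (simp add: sum_subtractf sum_distrib_left)
qed

text \<open>This is completion of the square; equality holds at y = g / w, which suggests the
  witness for the converse estimate.\<close>

lemma two_inner_minus_norm_sq_le:
  fixes g y :: "'a::real_inner"
  assumes "w > 0"
  shows "2 * (g \<bullet> y) - w * (norm y)\<^sup>2 \<le> (norm g)\<^sup>2 / w"
proof -
  have "0 \<le> (norm (g - w *\<^sub>R y))\<^sup>2" by simp
  also have "\<dots> = (norm g)\<^sup>2 - w * (2 * (g \<bullet> y) - w * (norm y)\<^sup>2)"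
    unfolding power2_norm_eq_inner
    by (simp add: inner_diff_left inner_diff_right inner_commute algebra_simps)
  finally show ?thesis using assms by (simp add: pos_le_divide_eq mult.commute)
qed

text \<open>Rows are stored as vectors, so right multiplication by the conjugate of \<open>B\<close>
  acts on each of them as B*, whose operator norm is that of \<open>B\<close>.\<close>

lemma row_mul_cnj: "(Z ** map_matrix cnj B) $ i = conj_transpose B *v (Z $ i)"
  by (simp add: vec_eq_iff matrix_matrix_mult_def matrix_vector_mult_def map_matrix_def mult.commute)

lemma norm_mul_cnj_le: "(norm ((Z ** map_matrix cnj B) $ i))\<^sup>2 \<le> (op_norm B)\<^sup>2 * (norm (Z $ i))\<^sup>2"
  using norm_mat_le_op_norm[of "conj_transpose B" "Z $ i"]
  unfolding row_mul_cnj op_norm_conj_transpose power_mult_distrib[symmetric] by (intro power_mono) auto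

lemma rank_one_mul: "M ** (\<chi> i a. x $ i * u $ a) = (\<chi> i a. (M *v x) $ i * u $ a)" for M :: "complex^'k^'l"
  by (simp add: vec_eq_iff matrix_matrix_mult_def matrix_vector_mult_def sum_distrib_right mult.assoc)

lemma rank_one_row: "(\<chi> i a. x $ i * u $ a) $ i = x $ i *s u" for x :: "complex^'k"
  by (simp add: vec_eq_iff)

lemma norm_scale_vec: "norm (c *s x) = cmod c * norm x" for x :: "complex^'n"
  by (simp add: norm_vec_def L2_set_def norm_mult power_mult_distrib sum_distrib_left[symmetric]
      real_sqrt_mult)

lemma norm_rank_one: "(norm (\<chi> i a. x $ i * u $ a))\<^sup>2 = (norm x)\<^sup>2 * (norm u)\<^sup>2"
  for x :: "complex^'k" and u :: "complex^'m"
  unfolding norm_sq_sum_rows[of "\<chi> i a. x $ i * u $ a"] rank_one_row norm_scale_vec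
  by (simp add: power_mult_distrib sum_distrib_right norm_sq_sum_rows[of x])

text \<open>For fixed \<open>X\<close> the best \<open>Y\<close> is found row by row, which leaves a
  condition on \<open>X\<close> alone. Rank-one \<open>X\<close> make the estimates for
  \<open>B\<close> sharp, giving necessity; for sufficiency the remaining form is summed over the
  columns of \<open>X\<close>.\<close>

lemma contraction_iff_schur:
  fixes C\<^sub>1 A C\<^sub>2 :: "complex^'k^'k" and B :: "complex^'n^'m"
  assumes diag: "diagonal_matrix (C\<^sub>2 ** conj_transpose C\<^sub>2)"
  defines "w \<equiv> \<lambda>i. 1 - Re ((C\<^sub>2 ** conj_transpose C\<^sub>2) $ i $ i)"
  shows "(\<forall>X Y. X \<noteq> 0 \<or> Y \<noteq> 0 \<longrightarrow>
      (norm (conj_transpose C\<^sub>1 ** X))\<^sup>2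
        + (norm (conj_transpose A ** X ** map_matrix cnj B + conj_transpose C\<^sub>2 ** Y))\<^sup>2
      < (norm X)\<^sup>2 + (norm Y)\<^sup>2) \<longleftrightarrow>
    (\<forall>i. 0 < w i) \<and>
    (\<forall>x. x \<noteq> 0 \<longrightarrow> (norm (conj_transpose C\<^sub>1 *v x))\<^sup>2 + (op_norm B)\<^sup>2 * (norm (conj_transpose A *v x))\<^sup>2
      + (op_norm B)\<^sup>2 * (\<Sum>i\<in>UNIV. (cmod ((C\<^sub>2 *v (conj_transpose A *v x)) $ i))\<^sup>2 / w i) < (norm x)\<^sup>2)"
  (is "(\<forall>X Y. _ \<longrightarrow> ?Q X Y) \<longleftrightarrow> _ \<and> (\<forall>x. _ \<longrightarrow> ?q x)")
proof (intro iffI conjI allI impI)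
  \<comment> \<open>Used with R = A* X cnj(B): the term \<open>(norm Y)\<^sup>2\<close> then cancels
    against the one on the right of \<open>?Q X Y\<close>.\<close>
  have na: "(norm (R + conj_transpose C\<^sub>2 ** Y))\<^sup>2 = (norm Y)\<^sup>2 + (norm R)\<^sup>2
      + (\<Sum>i\<in>UNIV. 2 * ((C\<^sub>2 ** R) $ i \<bullet> Y $ i) - w i * (norm (Y $ i))\<^sup>2)"
    for R Y :: "complex^'n^'k"
    unfolding w_def by (rule norm_sq_add_conj_transpose_mul[OF diag])
  define b where "b = op_norm B"
  {
    assume L: "\<forall>X Y. X \<noteq> 0 \<or> Y \<noteq> 0 \<longrightarrow> ?Q X Y"
    show w: "0 < w i" for i
    proof -
      \<comment> \<open>A single entry 1 in row \<open>i\<close>: with X = 0 only \<open>w i\<close>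
        survives in the inequality.\<close>
      let ?Y = "axis i (axis undefined 1) :: complex^'n^'k"
      have "?Y \<noteq> 0" by (simp add: axis_eq_0_iff)
      with L have "?Q 0 ?Y" by blast
      moreover have "(\<Sum>j\<in>UNIV. w j * (norm (?Y $ j))\<^sup>2) = (\<Sum>j\<in>UNIV. if j = i then w i else 0)"
        by (intro sum.cong) (auto simp: axis_def[of i] norm_axis_1)
      ultimately show ?thesis unfolding na by (simp add: sum_negf)
    qed
    fix x :: "complex^'k" assume "x \<noteq> 0"
    \<comment> \<open>A norming vector for B*, so that the factor \<open>b\<close> occurs with
      equality and not just as a bound.\<close>
    obtain u where u: "norm u = 1" "norm (conj_transpose B *v u) = op_norm (conj_transpose B)"
      using op_norm_attained by blast
    define v where "v = conj_transpose B *v u"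
    have v: "norm v = b" using u by (simp add: v_def b_def op_norm_conj_transpose)
    define X :: "complex^'m^'k" where "X = (\<chi> i a. x $ i * u $ a)"
    have nX: "(norm X)\<^sup>2 = (norm x)\<^sup>2" by (simp add: X_def norm_rank_one u)
    define y where "y = conj_transpose A *v x"
    have R: "conj_transpose A ** X ** map_matrix cnj B = (\<chi> i a. y $ i * v $ a)"
      unfolding X_def rank_one_mul y_def[symmetric]
      by (simp add: vec_eq_iff matrix_matrix_mult_def v_def matrix_vector_mult_def sum_distrib_left
          map_matrix_def mult_ac)
    define G where "G = C\<^sub>2 ** (\<chi> i a. y $ i * v $ a)"
    have G: "norm (G $ i) = cmod ((C\<^sub>2 *v y) $ i) * b" for i
      unfolding G_def rank_one_mul rank_one_row norm_scale_vec v ..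
    \<comment> \<open>the row-wise maximiser, i.e. \<open>W\<^sup>-\<^sup>1 C\<^sub>2 R\<close>\<close>
    define Y where "Y = (\<chi> i. (1 / w i) *\<^sub>R G $ i)"
    have "X \<noteq> 0" using nX \<open>x \<noteq> 0\<close> by auto
    with L have "?Q X Y" by blast
    \<comment> \<open>This is the maximal value of the completed square, with the norm of row
      \<open>i\<close> of \<open>G\<close> inserted.\<close>
    moreover have "2 * (G $ i \<bullet> Y $ i) - w i * (norm (Y $ i))\<^sup>2
        = b\<^sup>2 * ((cmod ((C\<^sub>2 *v y) $ i))\<^sup>2 / w i)" for i
      using w[of i] unfolding G[symmetric] Y_def
      by (simp add: G power_mult_distrib power_divide flip: power2_norm_eq_inner)
        (simp add: power2_eq_square field_simps)
    moreover have "(norm (conj_transpose C\<^sub>1 ** X))\<^sup>2 = (norm (conj_transpose C\<^sub>1 *v x))\<^sup>2"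
      unfolding X_def rank_one_mul norm_rank_one by (simp add: u)
    ultimately show "?q x"
      unfolding R na G_def[symmetric] norm_rank_one v nX
      by (simp add: b_def[symmetric] y_def[symmetric] sum_distrib_left mult.commute)
  }
  assume "(\<forall>i. 0 < w i) \<and> (\<forall>x. x \<noteq> 0 \<longrightarrow> ?q x)"
  then have w: "0 < w i" and q: "x \<noteq> 0 \<Longrightarrow> ?q x" for i x by auto
  fix X :: "complex^'m^'k" and Y :: "complex^'n^'k" assume XY: "X \<noteq> 0 \<or> Y \<noteq> 0"
  show "?Q X Y"
  \<comment> \<open>If X = 0, strictness has to come from a nonzero row of \<open>Y\<close>;
    otherwise it comes from a nonzero column of \<open>X\<close>.\<close>
  proof (cases "X = 0")
    case True
    with XY obtain j where "Y $ j \<noteq> 0" by (auto simp: vec_eq_iff)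
    with w have "0 < (\<Sum>i\<in>UNIV. w i * (norm (Y $ i))\<^sup>2)"
      by (intro sum_pos2[of _ j]) (auto simp: less_imp_le)
    with True show ?thesis unfolding na by (simp add: sum_negf)
  next
    case False
    then obtain j where j: "column j X \<noteq> 0" by (auto simp: vec_eq_iff column_def)
    let ?Z = "conj_transpose A ** X"
    let ?R = "?Z ** map_matrix cnj B"
    have "(norm ?R)\<^sup>2 \<le> b\<^sup>2 * (norm ?Z)\<^sup>2"
      unfolding norm_sq_sum_rows[of ?R] norm_sq_sum_rows[of ?Z] sum_distrib_left b_def
      by (intro sum_mono norm_mul_cnj_le)
    moreover have "(\<Sum>i\<in>UNIV. 2 * ((C\<^sub>2 ** ?R) $ i \<bullet> Y $ i) - w i * (norm (Y $ i))\<^sup>2)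
        \<le> b\<^sup>2 * (\<Sum>i\<in>UNIV. (norm ((C\<^sub>2 ** ?Z) $ i))\<^sup>2 / w i)"
    proof (unfold sum_distrib_left, intro sum_mono)
      fix i
      have "2 * ((C\<^sub>2 ** ?R) $ i \<bullet> Y $ i) - w i * (norm (Y $ i))\<^sup>2 \<le> (norm ((C\<^sub>2 ** ?R) $ i))\<^sup>2 / w i"
        by (rule two_inner_minus_norm_sq_le[OF w])
      \<comment> \<open>By associativity \<open>C\<^sub>2 ** ?R\<close> is
        \<open>C\<^sub>2 ** ?Z\<close> times the conjugate of \<open>B\<close>, so the row bound
        applies again.\<close>
      also have "\<dots> \<le> (b\<^sup>2 * (norm ((C\<^sub>2 ** ?Z) $ i))\<^sup>2) / w i"
        using norm_mul_cnj_le[of "C\<^sub>2 ** ?Z" B i] w[of i]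
        by (intro divide_right_mono) (auto simp: b_def matrix_mul_assoc)
      finally show "2 * ((C\<^sub>2 ** ?R) $ i \<bullet> Y $ i) - w i * (norm (Y $ i))\<^sup>2
          \<le> b\<^sup>2 * ((norm ((C\<^sub>2 ** ?Z) $ i))\<^sup>2 / w i)" by simp
    qed
    moreover have "(norm (conj_transpose C\<^sub>1 ** X))\<^sup>2 + b\<^sup>2 * (norm ?Z)\<^sup>2
        + b\<^sup>2 * (\<Sum>i\<in>UNIV. (norm ((C\<^sub>2 ** ?Z) $ i))\<^sup>2 / w i) < (norm X)\<^sup>2"
    proof -
      define f where "f x = (norm (conj_transpose C\<^sub>1 *v x))\<^sup>2 + b\<^sup>2 * (norm (conj_transpose A *v x))\<^sup>2
        + b\<^sup>2 * (\<Sum>i\<in>UNIV. (cmod ((C\<^sub>2 *v (conj_transpose A *v x)) $ i))\<^sup>2 / w i)" for x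
      have "(norm ((C\<^sub>2 ** ?Z) $ i))\<^sup>2 = (\<Sum>a\<in>UNIV. (cmod ((C\<^sub>2 *v (conj_transpose A *v column a X)) $ i))\<^sup>2)" for i
      proof -
        have "(C\<^sub>2 *v (conj_transpose A *v column a X)) $ i = (C\<^sub>2 ** ?Z) $ i $ a" for a
          unfolding column_matrix_mul[symmetric] by (simp add: column_def)
        then show ?thesis by (simp add: norm_sq_sum_rows)
      qed
      then have "(\<Sum>i\<in>UNIV. (norm ((C\<^sub>2 ** ?Z) $ i))\<^sup>2 / w i)
          = (\<Sum>a\<in>UNIV. \<Sum>i\<in>UNIV. (cmod ((C\<^sub>2 *v (conj_transpose A *v column a X)) $ i))\<^sup>2 / w i)"
        by (subst sum.swap) (simp add: sum_divide_distrib)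
      then have "(norm (conj_transpose C\<^sub>1 ** X))\<^sup>2 + b\<^sup>2 * (norm ?Z)\<^sup>2
        + b\<^sup>2 * (\<Sum>i\<in>UNIV. (norm ((C\<^sub>2 ** ?Z) $ i))\<^sup>2 / w i) = (\<Sum>a\<in>UNIV. f (column a X))"
        unfolding f_def norm_sq_sum_columns column_matrix_mul by (simp add: sum.distrib sum_distrib_left)
      also have "\<dots> < (\<Sum>a\<in>UNIV. (norm (column a X))\<^sup>2)"
      \<comment> \<open>Zero columns give equality, so strictness is claimed only at one nonzero
        column.\<close>
      proof (rule sum_strict_mono_ex1)
        have lt: "f x < (norm x)\<^sup>2" if "x \<noteq> 0" for x using q[OF that] unfolding f_def b_def .
        have "f 0 = 0" by (simp add: f_def)
        with lt show "\<forall>a\<in>UNIV. f (column a X) \<le> (norm (column a X))\<^sup>2"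
          by (metis less_imp_le norm_zero order_refl power_zero_numeral)
        show "\<exists>a\<in>UNIV. f (column a X) < (norm (column a X))\<^sup>2" using lt j by blast
      qed simp
      finally show ?thesis by (simp add: norm_sq_sum_columns[of X])
    qed
    ultimately show ?thesis unfolding na by simp
  qed
qed


section \<open>The Schur complement as a quadratic form\<close>

text \<open>\<open>matrix_inv\<close> is a choice among two-sided inverses, and these are
  unique.\<close>

lemma matrix_inv_eqI:
  assumes "A ** B = mat 1" and "B ** A = mat 1"
  shows "matrix_inv A = B"
proof -
  have "A ** matrix_inv A = mat 1 \<and> matrix_inv A ** A = mat 1"
    unfolding matrix_inv_def by (rule someI[of _ B]) (use assms in simp)
  then show ?thesis by (metis assms(2) matrix_mul_assoc matrix_mul_lid matrix_mul_rid)
qed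

text \<open>Since I - \<open>C\<^sub>2\<close> \<open>C\<^sub>2\<close>* is diagonal with entries
  \<open>w i\<close>, its form is a weighted sum of squares, and so is that of its inverse, with
  weights \<open>1 / w i\<close>.\<close>

lemma positive_definite_schur_iff:
  fixes C\<^sub>1 A C\<^sub>2 :: "complex^'k^'k"
  assumes diag: "diagonal_matrix (C\<^sub>2 ** conj_transpose C\<^sub>2)"
  defines "w \<equiv> \<lambda>i. 1 - Re ((C\<^sub>2 ** conj_transpose C\<^sub>2) $ i $ i)"
  shows "positive_definite (mat 1 - C\<^sub>2 ** conj_transpose C\<^sub>2) \<longleftrightarrow> (\<forall>i. 0 < w i)" (is ?thesis1)
    and "\<forall>i. 0 < w i \<Longrightarrow> positive_definite (mat 1 - C\<^sub>1 ** conj_transpose C\<^sub>1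
        - b\<^sup>2 *\<^sub>R (A ** conj_transpose A)
        - b\<^sup>2 *\<^sub>R (A ** conj_transpose C\<^sub>2 ** matrix_inv (mat 1 - C\<^sub>2 ** conj_transpose C\<^sub>2)
            ** C\<^sub>2 ** conj_transpose A)) \<longleftrightarrow>
      (\<forall>x. x \<noteq> 0 \<longrightarrow> (norm (conj_transpose C\<^sub>1 *v x))\<^sup>2 + b\<^sup>2 * (norm (conj_transpose A *v x))\<^sup>2
        + b\<^sup>2 * (\<Sum>i\<in>UNIV. (cmod ((C\<^sub>2 *v (conj_transpose A *v x)) $ i))\<^sup>2 / w i) < (norm x)\<^sup>2)"
      (is "_ \<Longrightarrow> positive_definite ?S \<longleftrightarrow> ?thesis2")
proof -
  define W where "W = mat 1 - C\<^sub>2 ** conj_transpose C\<^sub>2"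
  define diag_mat where "diag_mat v = (\<chi> i j. if i = j then complex_of_real (v i) else 0)"
    for v :: "'k \<Rightarrow> real"
  have herm: "conj_transpose (M ** conj_transpose M) = M ** conj_transpose M" for M :: "complex^'k^'k"
    by (simp add: conj_transpose_matrix_mul)
  \<comment> \<open>A Hermitian matrix has real diagonal, so taking \<open>Re\<close> in
    \<open>w\<close> loses nothing.\<close>
  have "Im ((C\<^sub>2 ** conj_transpose C\<^sub>2) $ i $ i) = 0" for i
    using arg_cong[OF herm[of C\<^sub>2], of "\<lambda>M. Im (M $ i $ i)"] by simp
  with diag have W: "W = diag_mat w"
    by (auto simp: W_def diag_mat_def vec_eq_iff mat_def w_def diagonal_matrix_def complex_eq_iff)
  have apply_diag: "diag_mat v *v x = (\<chi> i. v i *\<^sub>R x $ i)" for v x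
  proof -
    have "(\<Sum>j\<in>UNIV. (if i = j then complex_of_real (v i) else 0) * x $ j)
        = (\<Sum>j\<in>UNIV. if i = j then v i *\<^sub>R x $ i else 0)" for i
      by (intro sum.cong) (auto simp: scaleR_conv_of_real)
    then show ?thesis by (simp add: vec_eq_iff diag_mat_def matrix_vector_mult_def)
  qed
  have form_diag: "x \<bullet> (diag_mat v *v x) = (\<Sum>i\<in>UNIV. v i * (cmod (x $ i))\<^sup>2)" for v x
    unfolding apply_diag by (simp add: inner_vec_def power2_norm_eq_inner)
  have W_herm: "conj_transpose W = W" by (simp add: W_def conj_transpose_diff herm)
  show ?thesis1
    unfolding W_def[symmetric] positive_definite_iff
  proof (intro iffI conjI allI impI W_herm)
    fix i
    assume *: "conj_transpose W = W \<and> (\<forall>x. x \<noteq> 0 \<longrightarrow> 0 < x \<bullet> (W *v x))"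
    have "(axis i 1 :: complex^'k) \<noteq> 0" by (simp add: axis_eq_0_iff)
    with * have "0 < axis i 1 \<bullet> (W *v axis i 1)" by blast
    also have "\<dots> = (\<Sum>j\<in>UNIV. if j = i then w i else 0)"
      unfolding W form_diag by (intro sum.cong) (auto simp: axis_def)
    finally show "0 < w i" by simp
  next
    fix x :: "complex^'k" assume w: "\<forall>i. 0 < w i" and "x \<noteq> 0"
    then obtain j where "x $ j \<noteq> 0" by (auto simp: vec_eq_iff)
    with w show "0 < x \<bullet> (W *v x)"
      unfolding W form_diag by (intro sum_pos2[of _ j]) (auto simp: less_imp_le)
  qed
  assume w: "\<forall>i. 0 < w i"
  then have w0: "w i \<noteq> 0" for i by (metis less_irrefl)
  have diag_mul: "diag_mat u ** diag_mat v = diag_mat (\<lambda>i. u i * v i)" for u v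
    unfolding matrix_eq by (simp add: matrix_vector_mul_assoc[symmetric] apply_diag vec_eq_iff)
  have diag_1: "diag_mat (\<lambda>i. 1) = mat 1"
    by (auto simp: diag_mat_def mat_def vec_eq_iff)
  have inv: "matrix_inv W = diag_mat (\<lambda>i. 1 / w i)"
    unfolding W by (rule matrix_inv_eqI) (simp_all add: diag_mul diag_1 w0)
  have "conj_transpose (diag_mat v) = diag_mat v" for v
    by (auto simp: diag_mat_def vec_eq_iff)
  then have S_herm: "conj_transpose ?S = ?S"
    by (simp add: W_def[symmetric] inv conj_transpose_diff conj_transpose_scaleR
        conj_transpose_matrix_mul matrix_mul_assoc)
  have form: "x \<bullet> (?S *v x) = (norm x)\<^sup>2 - ((norm (conj_transpose C\<^sub>1 *v x))\<^sup>2
      + b\<^sup>2 * (norm (conj_transpose A *v x))\<^sup>2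
      + b\<^sup>2 * (\<Sum>i\<in>UNIV. (cmod ((C\<^sub>2 *v (conj_transpose A *v x)) $ i))\<^sup>2 / w i))" for x
  proof -
    have scale: "(c *\<^sub>R M) *v x = c *\<^sub>R (M *v x)" for c and M :: "complex^'k^'k"
      by (simp add: vec_eq_iff matrix_vector_mult_def scaleR_sum_right)
    have "x \<bullet> ((A ** conj_transpose C\<^sub>2 ** matrix_inv W ** C\<^sub>2 ** conj_transpose A) *v x)
        = (C\<^sub>2 *v (conj_transpose A *v x)) \<bullet> (matrix_inv W *v (C\<^sub>2 *v (conj_transpose A *v x)))"
      by (simp add: inner_conj_transpose_right conj_transpose_matrix_mul matrix_vector_mul_assoc
          matrix_mul_assoc)
    then show ?thesis
      unfolding W_def[symmetric] inv form_diag
      by (simp add: matrix_vector_mult_diff_rdistrib scale inner_diff_right inner_mul_conj_transpose power2_norm_eq_inner[of x])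
  qed
  show "positive_definite ?S \<longleftrightarrow> ?thesis2"
    unfolding positive_definite_iff form using S_herm by simp
qed

section \<open>Unitary invariance and conclusion\<close>

lemma norm_unitary_mul:
  assumes "unitary_matrix U"
  shows "norm (conj_transpose U ** X) = norm X"
proof -
  have "(norm (conj_transpose U ** X))\<^sup>2 = (norm X)\<^sup>2"
    unfolding power2_norm_eq_inner inner_matrix_mul_right
    using assms by (simp add: matrix_mul_assoc unitary_matrix_def)
  then show ?thesis by simp
qed

text \<open>Replacing \<open>X\<close> and \<open>Y\<close> by U* X and U* Y is a norm-preserving
  bijection that turns one condition into the other. Multiplication by \<open>U\<close> on the left
  alone suffices, because products of the form V W* then become U V W* U*.\<close>

lemma op_norm_block_unitary:
  assumes U: "unitary_matrix U"
  shows "op_norm (block_upper (U ** C\<^sub>1) (U ** A) (U ** C\<^sub>2) B) < 1 \<longleftrightarrow> op_norm (block_upper C\<^sub>1 A C\<^sub>2 B) < 1"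
proof -
  have U1: "conj_transpose U ** (U ** X) = X" "U ** (conj_transpose U ** X) = X" for X :: "complex^'l^_"
    using U by (simp_all add: matrix_mul_assoc unitary_matrix_def)
  have all: "(\<forall>X. P X) \<longleftrightarrow> (\<forall>X. P (conj_transpose U ** X))" for P :: "complex^'l^_ \<Rightarrow> bool"
    by (metis U1(1))
  have zero: "conj_transpose U ** X = 0 \<longleftrightarrow> X = 0" for X :: "complex^'l^_"
    using norm_unitary_mul[OF U, of X] by (metis norm_eq_zero)
  show ?thesis
    unfolding op_norm_block_less_1_iff
    by (subst (2) all, subst (2) all)
      (simp add: zero norm_unitary_mul[OF U] conj_transpose_matrix_mul matrix_mul_assoc)
qed

theorem theorem4p10:
  fixes \<alpha>\<^sub>1 \<alpha>\<^sub>2 \<beta> :: complex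
    and B :: "complex^'n^'m"
    and V\<^sub>1 V\<^sub>2 U D\<^sub>1 :: "complex^'k^'k"
  assumes "cmod \<beta> = op_norm B"
    and "unitary_matrix U"
    and "D\<^sub>1 = U ** V\<^sub>1 ** conj_transpose V\<^sub>1 ** conj_transpose U"
    and "diagonal_matrix D\<^sub>1"
  shows "op_norm (P\<^sub>B_amp \<alpha>\<^sub>1 \<alpha>\<^sub>2 B V\<^sub>1 V\<^sub>2) < 1 \<longleftrightarrow>
    positive_definite (mat 1 - (cmod \<alpha>\<^sub>2)\<^sup>2 *\<^sub>R D\<^sub>1) \<and>
    positive_definite
      (mat 1 - (cmod \<alpha>\<^sub>1)\<^sup>2 *\<^sub>R D\<^sub>1
        - (cmod \<beta>)\<^sup>2 *\<^sub>R (U ** V\<^sub>2 ** conj_transpose V\<^sub>2 ** conj_transpose U)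
        - (cmod (\<alpha>\<^sub>2 * \<beta>))\<^sup>2 *\<^sub>R
            (U ** V\<^sub>2 ** conj_transpose V\<^sub>1 ** conj_transpose U
              ** matrix_inv (mat 1 - (cmod \<alpha>\<^sub>2)\<^sup>2 *\<^sub>R D\<^sub>1)
              ** U ** V\<^sub>1 ** conj_transpose V\<^sub>2 ** conj_transpose U))"
proof -
  define A where "A = U ** V\<^sub>2"
  define C where "C c = scale_matrix c (U ** V\<^sub>1)" for c
  have D: "(cmod c)\<^sup>2 *\<^sub>R D\<^sub>1 = C c ** conj_transpose (C c)" for c
    unfolding C_def scale_mul_conj_transpose assms(3)
    by (simp add: conj_transpose_matrix_mul matrix_mul_assoc)
  have diag: "diagonal_matrix (C \<alpha>\<^sub>2 ** conj_transpose (C \<alpha>\<^sub>2))"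
    using assms(4) unfolding D[symmetric] by (simp add: diagonal_matrix_def)
  \<comment> \<open>The factor |\<alpha>2|^2 splits into \<alpha>2 and its conjugate, absorbed by
    \<open>C \<alpha>\<^sub>2\<close> and its adjoint, while |\<beta>|^2 stays outside as the
    squared norm of \<open>B\<close>.\<close>
  have cross: "(cmod (\<alpha>\<^sub>2 * \<beta>))\<^sup>2 *\<^sub>R
      (U ** V\<^sub>2 ** conj_transpose V\<^sub>1 ** conj_transpose U ** M ** U ** V\<^sub>1 ** conj_transpose V\<^sub>2 ** conj_transpose U)
    = (cmod \<beta>)\<^sup>2 *\<^sub>R (A ** conj_transpose (C \<alpha>\<^sub>2) ** M ** C \<alpha>\<^sub>2 ** conj_transpose A)" for M
  proof -
    have scale_left: "scale_matrix c X ** Y = scale_matrix c (X ** Y)" for c and X Y :: "complex^'k^'k"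
      by (simp add: vec_eq_iff matrix_matrix_mult_def sum_distrib_left mult_ac)
    have conj_scale: "conj_transpose (scale_matrix c X) = scale_matrix (cnj c) (conj_transpose X)"
      for c and X :: "complex^'k^'k"
      by (simp add: vec_eq_iff)
    have scale_scale: "scale_matrix c (scale_matrix (cnj c) X) = (cmod c)\<^sup>2 *\<^sub>R X"
      for c and X :: "complex^'k^'k"
      by (simp add: vec_eq_iff scaleR_conv_of_real[where 'a = complex] complex_norm_square mult_ac del: of_real_power)
    have scaleR_left: "(r *\<^sub>R X) ** Y = r *\<^sub>R (X ** Y)" for r and X Y :: "complex^'k^'k"
      by (simp add: vec_eq_iff matrix_matrix_mult_def scaleR_sum_right)
    show ?thesis
      by (simp add: A_def C_def conj_scale matrix_mul_scale_right scale_left scale_scale scaleR_left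
          conj_transpose_matrix_mul matrix_mul_assoc norm_mult power_mult_distrib mult.commute)
  qed
  have "op_norm (P\<^sub>B_amp \<alpha>\<^sub>1 \<alpha>\<^sub>2 B V\<^sub>1 V\<^sub>2) < 1 \<longleftrightarrow> op_norm (block_upper (C \<alpha>\<^sub>1) A (C \<alpha>\<^sub>2) B) < 1"
    unfolding P\<^sub>B_amp_def block_upper_def[symmetric] C_def A_def matrix_mul_scale_right[symmetric]
    by (rule op_norm_block_unitary[OF assms(2), symmetric])
  \<comment> \<open>The second equivalence for the Schur complement presupposes all
    \<open>w i\<close> positive, which is exactly the first conjunct.\<close>
  then show ?thesis
    unfolding cross D op_norm_block_less_1_iff contraction_iff_schur[OF diag] positive_definite_schur_iff(1)[OF diag]
    using positive_definite_schur_iff(2)[OF diag, of "C \<alpha>\<^sub>1" "cmod \<beta>" A] assms(1)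
    by (auto simp: A_def conj_transpose_matrix_mul matrix_mul_assoc)
qed

end
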